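(* Let $k$ and $l$ be non-negative integers. Let $\mathcal{H}$ be a collection of distinct sets $H_1,H_2,\dots,H_m$, all of them included in $[k+l]$. If $m>\binom{k+l}{l}$ then at least one of the following three conditions is true: (1) The $(k+1)$-singleton matrix can be found in the collection of the sets of $\mathcal{H}$ that have at most $l$ elements. (2) The $(l+1)$-cosingleton matrix can be found in the collection of the sets of $\mathcal{H}$ that have at least $l+1$ elements. (3) For some $i\neq j$, $H_j\subset H_i$, $|H_j|\leq l$ and $|H_i|\geq l+1$.
   Context: For a non-negative integer $n$, $[n]=\{1,2,\dots,n\}$ (with $[0]=\emptyset$). A 0-1 matrix $N$ with $a$ rows and $b$ columns can be found in a collection of sets $\mathcal{G}$ if there are distinct sets $G_1,\dots,G_a\in\mathcal{G}$ and distinct elements $e_1,\dots,e_b\in\bigcup_{G\in\mathcal{G}}G$ such that $N_{\alpha,\beta}=1$ if and only if $e_\beta\in G_\alpha$. For an integer $n\ge 1$, the $n$-singleton matrix $S^n$ is the 0-1 matrix with $n+1$ rows and $n$ columns such that $S^n_{i,j}=1$ iff $i=j+1$; the $n$-cosingleton matrix $\bar S^n$ is the 0-1 matrix with $n+1$ rows and $n$ columns such that $\bar S^n_{i,j}=0$ iff $i=j$. *)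

theory Defs
  imports "Jordan_Normal_Form.Matrix"
begin

text \<open>
  Rows and columns of the type \<open>mat\<close> are numbered from \<open>0\<close>. The conditions \<open>i = j + 1\<close> and
  \<open>i = j\<close> below relate a row index to a column index, so they read the same as with indices
  starting from \<open>1\<close>.
\<close>

definition found_in :: "nat mat \<Rightarrow> 'a set set \<Rightarrow> bool" where
  "found_in N \<G> \<longleftrightarrow>
    (\<exists>G e. inj_on G {..<dim_row N} \<and> (\<forall>\<alpha><dim_row N. G \<alpha> \<in> \<G>) \<and>
           inj_on e {..<dim_col N} \<and> (\<forall>\<beta><dim_col N. e \<beta> \<in> \<Union>\<G>) \<and>
           (\<forall>\<alpha><dim_row N. \<forall>\<beta><dim_col N. N $$ (\<alpha>, \<beta>) = 1 \<longleftrightarrow> e \<beta> \<in> G \<alpha>))"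

definition singleton_mat :: "nat \<Rightarrow> nat mat" where
  "singleton_mat n = mat (n + 1) n (\<lambda>(i, j). if i = j + 1 then 1 else 0)"

definition cosingleton_mat :: "nat \<Rightarrow> nat mat" where
  "cosingleton_mat n = mat (n + 1) n (\<lambda>(i, j). if i = j then 0 else 1)"

end

theory Submission
  imports Defs
begin

text \<open>
  Suppose that all three conditions fail. Call a set low if it has at most \<open>l\<close> elements and high
  otherwise. For a low set \<open>A\<close>, take a minimal set \<open>T\<close> disjoint from \<open>A\<close> that meets every other low
  set of size at least \<open>card A\<close>. By minimality every \<open>t \<in> T\<close> has a low set meeting \<open>T\<close> in \<open>t\<close> only,
  so \<open>card T \<le> k\<close>, as otherwise the singleton matrix appears with \<open>A\<close> as its zero row. Hence some
  set \<open>P A\<close> of size \<open>l\<close> satisfies \<open>A \<subseteq> P A \<subseteq> [k + l] - T\<close>. Dually, a high set \<open>B\<close> has a minimal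
  subset \<open>T\<close> that is contained in no other high set of size at most \<open>card B\<close>; then \<open>card T \<le> l\<close>, and
  we choose \<open>P B\<close> of size \<open>l\<close> with \<open>T \<subseteq> P B \<subseteq> B\<close>. The map \<open>P\<close> is injective: on sets of the same
  kind by the choice of \<open>T\<close>, and \<open>P A = P B\<close> with \<open>A\<close> low and \<open>B\<close> high would give \<open>A \<subseteq> B\<close>.
\<close>

lemma minimal_transversal:
  assumes "finite X" and "\<And>F. F \<in> \<F> \<Longrightarrow> F \<inter> X \<noteq> {}"
  obtains T where "T \<subseteq> X" "\<And>F. F \<in> \<F> \<Longrightarrow> F \<inter> T \<noteq> {}"
    "\<And>t. t \<in> T \<Longrightarrow> \<exists>F\<in>\<F>. F \<inter> T = {t}"
proof -
  define S where "S = {T. T \<subseteq> X \<and> (\<forall>F\<in>\<F>. F \<inter> T \<noteq> {})}"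
  have "finite S" "X \<in> S"
    using assms by (auto simp: S_def)
  then obtain T where "T \<in> S" and min: "\<And>T'. T' \<in> S \<Longrightarrow> T' \<subseteq> T \<Longrightarrow> T = T'"
    using finite_has_minimal[of S] by blast
  then have T: "T \<subseteq> X" "\<And>F. F \<in> \<F> \<Longrightarrow> F \<inter> T \<noteq> {}"
    by (auto simp: S_def)
  have "\<exists>F\<in>\<F>. F \<inter> T = {t}" if "t \<in> T" for t
  proof -
    have "T - {t} \<notin> S"
      using min[of "T - {t}"] that by blast
    then obtain F where "F \<in> \<F>" "F \<inter> (T - {t}) = {}"
      using T(1) by (auto simp: S_def)
    moreover from this have "F \<inter> T \<noteq> {}"
      using T(2) by blast
    ultimately show ?thesis
      by blast
  qed
  with T that show thesis
    by blast
qed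

lemma found_in_singleton_mat:
  assumes "A \<in> \<G>" "A \<inter> T = {}" "n \<le> card T" "finite T"
    and isolated: "\<And>t. t \<in> T \<Longrightarrow> \<exists>D\<in>\<G>. D \<inter> T = {t}"
  shows "found_in (singleton_mat n) \<G>"
proof -
  obtain e where e: "e ` {..<n} \<subseteq> T" "inj_on e {..<n}"
    using card_le_inj[of "{..<n}" T] assms(3,4) by auto
  obtain D where D: "\<And>t. t \<in> T \<Longrightarrow> D t \<in> \<G> \<and> D t \<inter> T = {t}"
    using isolated by metis
  define G where "G \<alpha> = (case \<alpha> of 0 \<Rightarrow> A | Suc i \<Rightarrow> D (e i))" for \<alpha>
  have eT: "e \<beta> \<in> T" if "\<beta> < n" for \<beta>
    using e(1) that by auto
  have mem: "e \<beta> \<in> G \<alpha> \<longleftrightarrow> \<alpha> = Suc \<beta>" if "\<alpha> < n + 1" "\<beta> < n" for \<alpha> \<beta>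
  proof (cases \<alpha>)
    case 0
    then show ?thesis
      using assms(2) eT[OF that(2)] by (auto simp: G_def)
  next
    case (Suc i)
    then have "i < n"
      using that by simp
    have "e \<beta> \<in> D (e i) \<longleftrightarrow> e \<beta> = e i"
      using D[OF eT[OF \<open>i < n\<close>]] eT[OF that(2)] by blast
    then show ?thesis
      using Suc inj_onD[OF e(2), of \<beta> i] \<open>i < n\<close> that by (auto simp: G_def)
  qed
  have G: "G \<alpha> \<in> \<G>" if "\<alpha> < n + 1" for \<alpha>
    using that assms(1) D eT by (auto simp: G_def split: nat.split)
  have "inj_on G {..<n + 1}"
  proof (rule linorder_inj_onI')
    fix i j assume ij: "i \<in> {..<n + 1}" "j \<in> {..<n + 1}" "i < j"
    then obtain \<beta> where "j = Suc \<beta>" "\<beta> < n"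
      by (cases j) auto
    then show "G i \<noteq> G j"
      using mem[of i \<beta>] mem[of j \<beta>] ij by auto
  qed
  moreover have "e \<beta> \<in> \<Union>\<G>" if "\<beta> < n" for \<beta>
    using mem[of "Suc \<beta>" \<beta>] G[of "Suc \<beta>"] that by auto
  ultimately show ?thesis
    unfolding found_in_def singleton_mat_def
    using G e(2) mem by (intro exI[of _ G] exI[of _ e]) auto
qed

lemma found_in_cosingleton_mat:
  assumes "A \<in> \<G>" "T \<subseteq> A" "n \<le> card T" "finite T"
    and isolated: "\<And>t. t \<in> T \<Longrightarrow> \<exists>D\<in>\<G>. T - D = {t}"
  shows "found_in (cosingleton_mat n) \<G>"
proof -
  obtain e where e: "e ` {..<n} \<subseteq> T" "inj_on e {..<n}"
    using card_le_inj[of "{..<n}" T] assms(3,4) by auto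
  obtain D where D: "\<And>t. t \<in> T \<Longrightarrow> D t \<in> \<G> \<and> T - D t = {t}"
    using isolated by metis
  define G where "G \<alpha> = (if \<alpha> < n then D (e \<alpha>) else A)" for \<alpha>
  have eT: "e \<beta> \<in> T" if "\<beta> < n" for \<beta>
    using e(1) that by auto
  have mem: "e \<beta> \<in> G \<alpha> \<longleftrightarrow> \<alpha> \<noteq> \<beta>" if "\<alpha> < n + 1" "\<beta> < n" for \<alpha> \<beta>
  proof (cases "\<alpha> < n")
    case False
    then show ?thesis
      using assms(2) eT[OF that(2)] that(2) by (auto simp: G_def)
  next
    case True
    have "e \<beta> \<in> D (e \<alpha>) \<longleftrightarrow> e \<beta> \<noteq> e \<alpha>"
      using D[OF eT[OF True]] eT[OF that(2)] by blast
    then show ?thesis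
      using inj_onD[OF e(2), of \<beta> \<alpha>] True that by (auto simp: G_def)
  qed
  have G: "G \<alpha> \<in> \<G>" for \<alpha>
    using assms(1) D eT by (auto simp: G_def)
  have "inj_on G {..<n + 1}"
  proof (rule linorder_inj_onI')
    fix i j assume ij: "i \<in> {..<n + 1}" "j \<in> {..<n + 1}" "i < j"
    then show "G i \<noteq> G j"
      using mem[of i i] mem[of j i] by auto
  qed
  moreover have "e \<beta> \<in> \<Union>\<G>" if "\<beta> < n" for \<beta>
    using mem[of n \<beta>] G[of n] that by auto
  ultimately show ?thesis
    unfolding found_in_def cosingleton_mat_def
    using G e(2) mem by (intro exI[of _ G] exI[of _ e]) auto
qed

lemma low_set_transversal:
  assumes "finite U" "\<And>D. D \<in> \<G> \<Longrightarrow> D \<subseteq> U" "A \<in> \<G>" "\<not> found_in (singleton_mat (n + 1)) \<G>"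
  obtains T where "T \<subseteq> U - A" "card T \<le> n"
    "\<And>D. D \<in> \<G> \<Longrightarrow> D \<noteq> A \<Longrightarrow> card A \<le> card D \<Longrightarrow> D \<inter> T \<noteq> {}"
proof -
  let ?\<F> = "{D \<in> \<G>. D \<noteq> A \<and> card A \<le> card D}"
  have "D \<inter> (U - A) \<noteq> {}" if "D \<in> ?\<F>" for D
    using that assms(1-3) card_seteq[of A D] finite_subset[of A U] by blast
  then obtain T where T: "T \<subseteq> U - A" "\<And>D. D \<in> ?\<F> \<Longrightarrow> D \<inter> T \<noteq> {}"
      "\<And>t. t \<in> T \<Longrightarrow> \<exists>D\<in>?\<F>. D \<inter> T = {t}"
    using minimal_transversal[of "U - A" ?\<F>] assms(1) by blast
  have "A \<inter> T = {}" "finite T"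
    using T(1) assms(1) finite_subset[of T "U - A"] by auto
  moreover have "\<exists>D\<in>\<G>. D \<inter> T = {t}" if "t \<in> T" for t
    using T(3)[OF that] by blast
  ultimately have "\<not> n + 1 \<le> card T"
    using found_in_singleton_mat[OF assms(3)] assms(4) by blast
  then show thesis
    using that[of T] T(1,2) by auto
qed

lemma high_set_transversal:
  assumes "\<And>D. D \<in> \<G> \<Longrightarrow> finite D" "A \<in> \<G>" "\<not> found_in (cosingleton_mat (n + 1)) \<G>"
  obtains T where "T \<subseteq> A" "card T \<le> n"
    "\<And>D. D \<in> \<G> \<Longrightarrow> D \<noteq> A \<Longrightarrow> card D \<le> card A \<Longrightarrow> \<not> T \<subseteq> D"
proof -
  let ?\<F> = "(\<lambda>D. A - D) ` {D \<in> \<G>. D \<noteq> A \<and> card D \<le> card A}"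
  have meets: "F \<inter> A \<noteq> {}" if F: "F \<in> ?\<F>" for F
  proof -
    obtain D where D: "D \<in> \<G>" "D \<noteq> A" "card D \<le> card A" "F = A - D"
      using F by blast
    then have "\<not> A \<subseteq> D"
      using card_seteq[of D A] assms(1) by blast
    with D show ?thesis
      by blast
  qed
  obtain T where T: "T \<subseteq> A" "\<And>F. F \<in> ?\<F> \<Longrightarrow> F \<inter> T \<noteq> {}"
      "\<And>t. t \<in> T \<Longrightarrow> \<exists>F\<in>?\<F>. F \<inter> T = {t}"
    by (rule minimal_transversal[of A ?\<F>, OF assms(1)[OF assms(2)] meets]) (assumption, rule that)
  have "\<exists>D\<in>\<G>. T - D = {t}" if "t \<in> T" for t
    using T(3)[OF that] T(1) by blast
  then have "\<not> n + 1 \<le> card T"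
    using found_in_cosingleton_mat[OF assms(2) T(1), of "n + 1"] assms
      finite_subset[OF T(1)] by blast
  moreover have "\<not> T \<subseteq> D" if "D \<in> \<G>" "D \<noteq> A" "card D \<le> card A" for D
    using T(2)[of "A - D"] that by blast
  ultimately show thesis
    using that[of T] T(1) by auto
qed

lemma card_le_choose_if_not_found:
  assumes "finite U" "card U = k + l" "\<And>A. A \<in> \<H> \<Longrightarrow> A \<subseteq> U"
    and low: "\<not> found_in (singleton_mat (k + 1)) {A \<in> \<H>. card A \<le> l}"
    and high: "\<not> found_in (cosingleton_mat (l + 1)) {A \<in> \<H>. card A \<ge> l + 1}"
    and cross: "\<And>A B. A \<in> \<H> \<Longrightarrow> B \<in> \<H> \<Longrightarrow> card A \<le> l \<Longrightarrow> card B \<ge> l + 1 \<Longrightarrow> \<not> A \<subseteq> B"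
  shows "card \<H> \<le> (k + l) choose l"
proof -
  have fin: "finite A" if "A \<in> \<H>" for A
    using that assms(1,3) finite_subset by blast
  have "\<exists>P. P \<subseteq> U \<and> card P = l \<and> A \<subseteq> P \<and>
      (\<forall>D\<in>\<H>. card D \<le> l \<longrightarrow> D \<noteq> A \<longrightarrow> card A \<le> card D \<longrightarrow> \<not> D \<subseteq> P)"
    if A: "A \<in> \<H>" "card A \<le> l" for A
  proof -
    obtain T where T: "T \<subseteq> U - A" "card T \<le> k"
      "\<And>D. D \<in> {A \<in> \<H>. card A \<le> l} \<Longrightarrow> D \<noteq> A \<Longrightarrow> card A \<le> card D \<Longrightarrow> D \<inter> T \<noteq> {}"
      using low_set_transversal[OF assms(1) _ _ low, of A] assms(3) A by blast
    have "card (U - T) = k + l - card T"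
      using T(1) assms(1,2) by (subst card_Diff_subset) (auto intro: finite_subset)
    then have "l \<le> card (U - T)"
      using T(2) by linarith
    moreover have "A \<subseteq> U - T"
      using T(1) assms(3)[OF A(1)] by blast
    ultimately obtain P where P: "A \<subseteq> P" "P \<subseteq> U - T" "card P = l"
      using exists_subset_between[OF A(2)] assms(1) by (metis finite_Diff)
    have "\<not> D \<subseteq> P" if "D \<in> \<H>" "card D \<le> l" "D \<noteq> A" "card A \<le> card D" for D
      using T(3)[of D] P(2) that by blast
    with P show ?thesis
      by (intro exI[of _ P]) auto
  qed
  then obtain P where P: "\<And>A. A \<in> \<H> \<Longrightarrow> card A \<le> l \<Longrightarrow> P A \<subseteq> U \<and> card (P A) = l \<and> A \<subseteq> P A \<and>
      (\<forall>D\<in>\<H>. card D \<le> l \<longrightarrow> D \<noteq> A \<longrightarrow> card A \<le> card D \<longrightarrow> \<not> D \<subseteq> P A)"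
    by metis
  have "\<exists>Q. Q \<subseteq> B \<and> card Q = l \<and>
      (\<forall>D\<in>\<H>. card D \<ge> l + 1 \<longrightarrow> D \<noteq> B \<longrightarrow> card D \<le> card B \<longrightarrow> \<not> Q \<subseteq> D)"
    if B: "B \<in> \<H>" "card B \<ge> l + 1" for B
  proof -
    obtain T where T: "T \<subseteq> B" "card T \<le> l"
      "\<And>D. D \<in> {A \<in> \<H>. card A \<ge> l + 1} \<Longrightarrow> D \<noteq> B \<Longrightarrow> card D \<le> card B \<Longrightarrow> \<not> T \<subseteq> D"
      using high_set_transversal[OF _ _ high, of B] fin B by blast
    have "l \<le> card B"
      using B(2) by simp
    then obtain Q where Q: "T \<subseteq> Q" "Q \<subseteq> B" "card Q = l"
      using exists_subset_between[OF T(2) _ T(1) fin[OF B(1)]] by blast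
    have "\<not> Q \<subseteq> D" if "D \<in> \<H>" "card D \<ge> l + 1" "D \<noteq> B" "card D \<le> card B" for D
      using T(3)[of D] Q(1) that by blast
    with Q show ?thesis
      by (intro exI[of _ Q]) auto
  qed
  then obtain Q where Q: "\<And>B. B \<in> \<H> \<Longrightarrow> card B \<ge> l + 1 \<Longrightarrow> Q B \<subseteq> B \<and> card (Q B) = l \<and>
      (\<forall>D\<in>\<H>. card D \<ge> l + 1 \<longrightarrow> D \<noteq> B \<longrightarrow> card D \<le> card B \<longrightarrow> \<not> Q B \<subseteq> D)"
    by metis
  define R where "R A = (if card A \<le> l then P A else Q A)" for A
  have R_neq: "R A \<noteq> R B" if "A \<in> \<H>" "B \<in> \<H>" "A \<noteq> B" "card A \<le> card B" for A B
  proof -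
    consider "card B \<le> l" | "card A \<le> l" "card B \<ge> l + 1" | "card A \<ge> l + 1"
      by linarith
    then show ?thesis
    proof cases
      case 1
      then have "card A \<le> l"
        using that(4) by simp
      have "B \<subseteq> P B"
        using P[OF that(2) 1] by blast
      moreover have "\<not> B \<subseteq> P A"
        using P[OF that(1) \<open>card A \<le> l\<close>] 1 that(2-4) by blast
      ultimately show ?thesis
        using 1 \<open>card A \<le> l\<close> by (auto simp: R_def)
    next
      case 2
      have "A \<subseteq> P A"
        using P[OF that(1) 2(1)] by blast
      moreover have "Q B \<subseteq> B"
        using Q[OF that(2) 2(2)] by blast
      moreover have "\<not> A \<subseteq> B"
        using cross that(1,2) 2 by blast
      ultimately show ?thesis
        using 2 by (auto simp: R_def)
    next
      case 3
      then have "card B \<ge> l + 1"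
        using that(4) by simp
      have "Q A \<subseteq> A"
        using Q[OF that(1) 3] by blast
      moreover have "\<not> Q B \<subseteq> A"
        using Q[OF that(2) \<open>card B \<ge> l + 1\<close>] 3 that(1,3,4) by blast
      ultimately show ?thesis
        using 3 \<open>card B \<ge> l + 1\<close> by (auto simp: R_def)
    qed
  qed
  have "inj_on R \<H>"
  proof (rule inj_onI, rule ccontr)
    fix A B assume AB: "A \<in> \<H>" "B \<in> \<H>" "R A = R B" "A \<noteq> B"
    then show False
      using R_neq[of A B] R_neq[of B A] by (cases "card A \<le> card B") auto
  qed
  moreover have "R A \<subseteq> U \<and> card (R A) = l" if A: "A \<in> \<H>" for A
  proof (cases "card A \<le> l")
    case True
    then show ?thesis
      using P[OF A True] by (simp add: R_def)
  next
    case False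
    then have "Q A \<subseteq> A \<and> card (Q A) = l"
      using Q[OF A] by simp
    then show ?thesis
      using False assms(3)[OF A] by (auto simp: R_def)
  qed
  then have "R ` \<H> \<subseteq> {S. S \<subseteq> U \<and> card S = l}"
    by blast
  moreover have "finite {S. S \<subseteq> U \<and> card S = l}"
    using assms(1) by simp
  ultimately have "card \<H> \<le> card {S. S \<subseteq> U \<and> card S = l}"
    by (rule card_inj_on_le)
  then show ?thesis
    using n_subsets[OF assms(1)] assms(2) by simp
qed

theorem theorem5:
  fixes k l m :: nat and H :: "nat \<Rightarrow> nat set"
  assumes "inj_on H {1..m}"
    and "\<forall>i\<in>{1..m}. H i \<subseteq> {1..k + l}"
    and "m > (k + l) choose l"
  shows "found_in (singleton_mat (k + 1)) {H i | i. i \<in> {1..m} \<and> card (H i) \<le> l} \<or>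
         found_in (cosingleton_mat (l + 1)) {H i | i. i \<in> {1..m} \<and> card (H i) \<ge> l + 1} \<or>
         (\<exists>i\<in>{1..m}. \<exists>j\<in>{1..m}. i \<noteq> j \<and> H j \<subset> H i \<and> card (H j) \<le> l \<and> card (H i) \<ge> l + 1)"
proof (rule ccontr)
  assume neg: "\<not> ?thesis"
  let ?\<H> = "H ` {1..m}"
  have eqs: "{H i | i. i \<in> {1..m} \<and> card (H i) \<le> l} = {A \<in> ?\<H>. card A \<le> l}"
    "{H i | i. i \<in> {1..m} \<and> card (H i) \<ge> l + 1} = {A \<in> ?\<H>. card A \<ge> l + 1}"
    by blast+
  note neg = neg[unfolded eqs de_Morgan_disj]
  note not_sing = neg[THEN conjunct1] and not_cosing = neg[THEN conjunct2, THEN conjunct1]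
    and not_cross = neg[THEN conjunct2, THEN conjunct2]
  have cross: "\<not> A \<subseteq> B" if AB: "A \<in> ?\<H>" "B \<in> ?\<H>" "card A \<le> l" "card B \<ge> l + 1" for A B
  proof
    assume "A \<subseteq> B"
    obtain j i where ij: "j \<in> {1..m}" "A = H j" "i \<in> {1..m}" "B = H i"
      using AB(1,2) by (elim imageE)
    have "A \<noteq> B"
      using AB(3,4) by auto
    with \<open>A \<subseteq> B\<close> have "i \<noteq> j \<and> H j \<subset> H i"
      using ij(2,4) by blast
    then show False
      using not_cross ij AB(3,4) by metis
  qed
  have "card ?\<H> \<le> (k + l) choose l"
  proof (rule card_le_choose_if_not_found[OF _ _ _ not_sing not_cosing cross])
    show "A \<subseteq> {1..k + l}" if "A \<in> ?\<H>" for A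
      using that assms(2) by blast
  qed auto
  then show False
    using assms(1,3) by (simp add: card_image)
qed

end
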